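(* Let $A=\{a_s(n_s)\}_{s=1}^k$ be an exact covering system which is not the trivial ECS $\{0(1)\}$. Suppose that $A$ has a maximal modulus of the form $p_1^{k_1}p_2^{k_2}$, where $p_1,p_2$ are primes and $k_1,k_2\geq 0$ are integers. Then $A$ primely splits some exact covering system $B$.
   Context: For integers $a$ and $n\geq 1$, $a(n)$ denotes the arithmetic progression $a+n\mathbb{Z}$, and $n$ is its modulus. An exact covering system (ECS) is a finite list $\{a_s(n_s)\}_{s=1}^k$ of arithmetic progressions (repetitions of moduli allowed) which partitions $\mathbb{Z}$, i.e. every integer lies in exactly one of them. The trivial ECS is $\{0(1)\}$. A modulus $n_r$ of an ECS is maximal if it is maximal with respect to divisibility among the moduli, i.e. it does not properly divide any other modulus of the ECS. An ECS $A$ primely splits an ECS $B$ (written $A\models B$) if there is a prime $p$ such that, after reordering, $B=\{a_i(n_i)\}_{i=1}^k$ and $A=\{a_i(n_i)\}_{i=1}^{k-1}\cup\{a_k+jn_k\,(pn_k)\}_{j=0}^{p-1}$; that is, $A$ is obtained from $B$ by splitting one progression $a_k(n_k)$ into the $p$ progressions $a_k+jn_k+pn_k\mathbb{Z}$, $0\le j\le p-1$. *)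

theory Defs
  imports "HOL-Library.Multiset" "HOL-Computational_Algebra.Primes"
begin

fun progression :: "int \<times> nat \<Rightarrow> int set" where
  "progression (a, n) = {a + int n * t | t. True}"

definition ECS :: "(int \<times> nat) list \<Rightarrow> bool" where
  "ECS A \<longleftrightarrow> (\<forall>(a, n)\<in>set A. n \<ge> 1) \<and>
     (\<forall>x::int. \<exists>!s. s < length A \<and> x \<in> progression (A ! s))"

text \<open>
  Different pairs may denote the same progression (the offset matters only modulo the modulus),
  and the order of the progressions is irrelevant. Systems are therefore compared through the
  multisets of subsets of the integers that they list.
\<close>

definition progressions :: "(int \<times> nat) list \<Rightarrow> int set multiset" where
  "progressions A = mset (map progression A)"

definition maximal_modulus :: "(int \<times> nat) list \<Rightarrow> nat \<Rightarrow> bool" where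
  "maximal_modulus A n \<longleftrightarrow> n \<in> snd ` set A \<and> (\<forall>m\<in>snd ` set A. n dvd m \<longrightarrow> m = n)"

definition primely_splits :: "(int \<times> nat) list \<Rightarrow> (int \<times> nat) list \<Rightarrow> bool" (infix "\<Turnstile>" 50) where
  "A \<Turnstile> B \<longleftrightarrow> (\<exists>C a n p. n \<ge> 1 \<and> prime p \<and>
     progressions B = progressions (C @ [(a, n)]) \<and>
     progressions A = progressions (C @ map (\<lambda>j. (a + int j * int n, p * n)) [0..<p]))"

end

theory Submission
  imports Defs "HOL-Library.Periodic_Fun"
begin

text \<open>
  Let \<open>n\<close> be the maximal modulus and \<open>f\<close> the indicator of the union of the progressions of
  modulus \<open>n\<close>. Averaging the identity \<open>\<Sum>\<^sub>s 1\<^bsub>a\<^sub>s(n\<^sub>s)\<^esub> = 1\<close> over translations by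
  multiples of \<open>n\<close> turns the term of \<open>s\<close> into a function of period \<open>gcd n\<^sub>s n\<close>. By
  maximality this is a proper divisor of \<open>n\<close> unless \<open>n\<^sub>s = n\<close>, hence it divides \<open>d = n/p\<close> or
  \<open>e = n/q\<close>, where \<open>p\<close>, \<open>q\<close> are the prime divisors of \<open>n\<close>. So the mixed difference
  \<open>f(x+d+e) - f(x+d) - f(x+e) + f(x)\<close> vanishes. It follows that
  \<open>f(x+id+je) + f(x) = f(x+id) + f(x+je)\<close>, so if \<open>f(x) = 1\<close> then \<open>f\<close>, being nonnegative,
  cannot vanish both at some \<open>x+id\<close> and at some \<open>x+je\<close>. Hence \<open>p\<close> or \<open>q\<close> progressions of modulus \<open>n\<close> merge into one.
\<close>

section \<open>Progressions, and exact covering as counting in multisets\<close>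

lemma mem_progression_iff: "x \<in> progression (a, n) \<longleftrightarrow> int n dvd x - a"
proof -
  have "x = a + int n * t \<longleftrightarrow> x - a = int n * t" for t by linarith
  then show ?thesis by (simp add: dvd_def)
qed

lemma progression_eqI:
  assumes "b \<in> progression (a, n)"
  shows "progression (a, n) = progression (b, n)"
proof -
  have "int n dvd b - a" using assms unfolding mem_progression_iff .
  then have "int n dvd x - a \<longleftrightarrow> int n dvd x - b" for x
    using dvd_add_left_iff[of "int n" "b - a" "x - b"] by simp
  then show ?thesis by (intro set_eqI) (simp only: mem_progression_iff)
qed

lemma ex1_iff_card: "(\<exists>!x. P x) \<longleftrightarrow> card {x. P x} = 1"
  by (auto simp: card_1_singleton_iff set_eq_iff Ex1_def)

text \<open>This form depends only on the multiset of entries, so entries can be regrouped and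
  exchanged without list positions.\<close>

lemma ECS_iff:
  "ECS A \<longleftrightarrow> (\<forall>s\<in>#mset A. snd s \<ge> 1) \<and>
     (\<forall>x. size {#s \<in># mset A. x \<in> progression s#} = 1)"
proof -
  have "(\<exists>!s. s < length A \<and> x \<in> progression (A ! s)) \<longleftrightarrow>
      size {#s \<in># mset A. x \<in> progression s#} = 1" for x
    unfolding ex1_iff_card by (simp add: length_filter_conv_card flip: mset_filter)
  then show ?thesis unfolding ECS_def by (auto simp: case_prod_beta)
qed

text \<open>An \<open>x\<close> in \<open>c(d)\<close> lies in exactly one of the \<open>p\<close>
  pieces: the index \<open>j\<close> is the residue of \<open>(x - c) div d\<close> modulo
  \<open>p\<close>. Any other \<open>x\<close> lies in none.\<close>

lemma size_filter_split_progression: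
  assumes "d \<ge> 1" "p \<ge> 1"
  shows "size {#s \<in># mset (map (\<lambda>j. (c + int j * int d, p * d)) [0..<p]). x \<in> progression s#} =
    size {#s \<in># {#(c, d)#}. x \<in> progression s#}"
proof -
  have *: "int (p * d) dvd x - (c + int j * int d) \<longleftrightarrow>
      int d dvd x - c \<and> int p dvd (x - c) div int d - int j" for j
  proof (cases "int d dvd x - c")
    case True
    then obtain t where t: "x - c = int d * t" by (auto elim: dvdE)
    then have "x - (c + int j * int d) = int d * (t - int j)" by (simp add: algebra_simps)
    then show ?thesis using assms t by (simp add: mult.commute[of "int p"])
  next
    case False
    have "\<not> int d dvd x - (c + int j * int d)"
    proof
      assume "int d dvd x - (c + int j * int d)"
      then have "int d dvd x - (c + int j * int d) + int j * int d"
        by (intro dvd_add) auto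
      then show False using False by simp
    qed
    then show ?thesis using False by (auto dest: dvd_mult_right)
  qed
  have **: "int p dvd t - int j \<longleftrightarrow> j = nat (t mod int p)" if "j < p" for t j
    using that assms by (auto simp flip: mod_eq_dvd_iff)
  have lt: "nat (t mod int p) < p" for t
    using assms by (simp add: nat_less_iff)
  have "size {#s \<in># mset (map (\<lambda>j. (c + int j * int d, p * d)) [0..<p]). x \<in> progression s#} =
      card {j. j < p \<and> int (p * d) dvd x - (c + int j * int d)}"
    by (simp only: size_mset length_filter_conv_card flip: mset_filter)
      (auto simp: mem_progression_iff simp del: progression.simps intro!: arg_cong[where f = card])
  also have "{j. j < p \<and> int (p * d) dvd x - (c + int j * int d)} =
      (if int d dvd x - c then {nat (((x - c) div int d) mod int p)} else {})"
    unfolding * using ** lt by auto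
  finally show ?thesis
    by (simp add: mem_progression_iff del: progression.simps)
qed

text \<open>Splitting is reversed: the \<open>p\<close> pieces of \<open>c(d)\<close> found in
  \<open>A\<close> are replaced by \<open>c(d)\<close> itself. Every integer is covered equally
  often before and after, so exactness survives.\<close>

lemma ECS_merge:
  assumes "ECS A" "prime p" "d \<ge> 1"
    and ex: "\<And>j. j < p \<Longrightarrow> \<exists>s\<in>set A. progression s = progression (c + int j * int d, p * d)"
  shows "\<exists>B. ECS B \<and> A \<Turnstile> B"
proof -
  obtain s where s: "\<And>j. j < p \<Longrightarrow> s j \<in> set A"
      "\<And>j. j < p \<Longrightarrow> progression (s j) = progression (c + int j * int d, p * d)"
    using ex by metis
  \<comment> \<open>Different \<open>j\<close> give different residue classes modulo
    \<open>p * d\<close>, so the chosen entries are distinct and can be removed from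
    \<open>A\<close> together.\<close>
  have "inj_on s {..<p}"
  proof (rule inj_onI)
    fix i j assume ij: "i \<in> {..<p}" "j \<in> {..<p}" "s i = s j"
    have "c + int i * int d \<in> progression (c + int j * int d, p * d)"
      using s(2)[of i] s(2)[of j] ij mem_progression_iff[of "c + int i * int d" "c + int i * int d" "p * d"]
      by simp
    then have "int p * int d dvd (int i - int j) * int d"
      by (simp add: mem_progression_iff algebra_simps del: progression.simps)
    then have "int p dvd int i - int j"
      using assms(3) by (metis dvd_times_right_cancel_iff int_ops(1) nat_int not_one_le_zero)
    then have "int i mod int p = int j mod int p" by (simp add: mod_eq_dvd_iff)
    then show "i = j" using ij by (simp flip: of_nat_mod)
  qed
  then have "distinct (map s [0..<p])"
    by (simp add: distinct_map atLeast0LessThan)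
  moreover have "set (map s [0..<p]) \<subseteq> set A" using s(1) by auto
  ultimately have "mset (map s [0..<p]) \<subseteq># mset A"
    by (metis List.finite_set mset_set_set mset_set_set_mset_msubset
        set_mset_mset subset_imp_msubset_mset_set subset_mset.trans)
  then obtain N where "mset A = mset (map s [0..<p]) + N"
    by (auto simp: subset_mset.le_iff_add)
  moreover obtain C where "mset C = N" using ex_mset by blast
  ultimately have A: "mset A = mset C + mset (map s [0..<p])" by simp
  define L where "L = map (\<lambda>j. (c + int j * int d, p * d)) [0..<p]"
  \<comment> \<open>The entries \<open>s j\<close> may carry other offsets than those in
    \<open>L\<close>; only the sets they denote agree.\<close>
  have eq: "image_mset progression (mset (map s [0..<p])) = image_mset progression (mset L)"
    unfolding L_def mset_map[symmetric] map_map
    by (intro arg_cong[where f = mset] map_cong) (auto simp: s(2) simp del: progression.simps)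
  have size_eq: "size {#t \<in># M. x \<in> progression t#} = size {#P \<in># image_mset progression M. x \<in> P#}"
    for x M by (simp add: filter_mset_image_mset)
  have "size {#t \<in># mset (C @ [(c, d)]). x \<in> progression t#} =
      size {#t \<in># mset A. x \<in> progression t#}" for x
  proof -
    have "size {#t \<in># {#(c, d)#}. x \<in> progression t#} = size {#t \<in># mset L. x \<in> progression t#}"
      unfolding L_def
      using size_filter_split_progression[OF assms(3) prime_ge_1_nat[OF assms(2)]] by (rule sym)
    also have "\<dots> = size {#t \<in># mset (map s [0..<p]). x \<in> progression t#}"
      unfolding size_eq eq ..
    finally show ?thesis by (simp only: A mset_append mset.simps filter_union_mset size_union)
  qed
  then have "ECS (C @ [(c, d)])"
    using assms(1,3) A unfolding ECS_iff
    by (auto simp del: progression.simps)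
  moreover have "progressions A = progressions (C @ L)"
    using eq A by (simp add: progressions_def del: progression.simps)
  then have "A \<Turnstile> C @ [(c, d)]"
    unfolding primely_splits_def L_def using assms(2,3) by blast
  ultimately show ?thesis by blast
qed

section \<open>Mixed differences and averaging over translates\<close>

lemma mixed_difference_zero:
  fixes f :: "int \<Rightarrow> int"
  assumes "\<And>x. f (x + d + e) + f x = f (x + d) + f (x + e)"
  shows "f (x + int i * d + int j * e) + f x = f (x + int i * d) + f (x + int j * e)"
proof -
  \<comment> \<open>First \<open>i\<close> steps in direction \<open>d\<close> against one step
    \<open>e\<close>, for every base point, since the induction on \<open>j\<close> uses it at
    \<open>x + int j * e\<close>.\<close>
  have *: "f (x + int i * d + e) + f x = f (x + int i * d) + f (x + e)" for x i
  proof (induction i)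
    case (Suc i)
    then show ?case using assms[of "x + int i * d"] by (simp add: algebra_simps)
  qed simp
  show ?thesis
  proof (induction j)
    case (Suc j)
    then show ?case using *[of "x + int j * e" i] by (simp add: algebra_simps)
  qed simp
qed

text \<open>Each summand has period \<open>m\<close>, and a shift by \<open>n\<close> permutes the
  summands cyclically. By Bezout \<open>gcd m n\<close> is a period, hence so is its multiple
  \<open>d\<close>.\<close>

lemma sum_translates_periodic:
  fixes a x :: int
  assumes "m dvd M" "gcd m n dvd d"
  defines "F \<equiv> \<lambda>x. \<Sum>j<M. of_bool (x + int n * int j \<in> progression (a, m)) :: int"
  shows "F (x + int d) = F x"
proof -
  have shift: "F (x + int m * u) = F x" for x u
  proof -
    have "int m dvd x + int m * u + t - a \<longleftrightarrow> int m dvd x + t - a" for t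
      using dvd_add_left_iff[of "int m" "int m * u" "x + t - a"] by (simp add: algebra_simps)
    then show ?thesis unfolding F_def mem_progression_iff by simp
  qed
  interpret periodic_fun_simple F "int n"
  proof
    fix x
    define h where "h = (\<lambda>j. of_bool (x + int n * int j \<in> progression (a, m)) :: int)"
    \<comment> \<open>As \<open>m\<close> divides \<open>M\<close>, the term that enters at index
      \<open>M\<close> equals the one that leaves at index 0.\<close>
    have "int m dvd int n * int M + (x - a) \<longleftrightarrow> int m dvd x - a"
      using assms(1) by (intro dvd_add_right_iff) auto
    then have "h M = h 0"
      by (simp add: h_def mem_progression_iff algebra_simps del: progression.simps)
    moreover have "h 0 + (\<Sum>j<M. h (Suc j)) = (\<Sum>j<M. h j) + h M"
      using sum.lessThan_Suc[of h M] sum.lessThan_Suc_shift[of h M] by simp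
    moreover have "F x = (\<Sum>j<M. h j)" "F (x + int n) = (\<Sum>j<M. h (Suc j))"
      by (simp_all add: F_def h_def algebra_simps del: progression.simps)
    ultimately show "F (x + int n) = F x" by simp
  qed
  obtain u v where "int d = int m * u + int n * v"
  proof -
    obtain u v where "u * int m + v * int n = gcd (int m) (int n)"
      using bezout_int by blast
    moreover obtain k where "int d = gcd (int m) (int n) * k"
      using assms(2) by (metis dvdE gcd_int_int_eq int_dvd_int_iff)
    ultimately have "int d = int m * (u * k) + int n * (v * k)"
      by (simp add: algebra_simps) (metis distrib_left mult.commute mult.left_commute)
    then show ?thesis using that by blast
  qed
  then have "F (x + int d) = F (x + int m * u + of_int v * int n)"
    by (simp add: algebra_simps)
  also have "\<dots> = F x" unfolding plus_of_int shift ..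
  finally show ?thesis .
qed

text \<open>Summed over translates, all entries together give a constant. Those of modulus
  \<open>n\<close> give a multiple of \<open>f\<close>, and each other one has period
  \<open>d\<close> or \<open>e\<close>, so its mixed difference is zero.\<close>

lemma ECS_mixed_difference:
  assumes "ECS A"
    and dvd: "\<And>s. s \<in> set A \<Longrightarrow> snd s \<noteq> n \<Longrightarrow> gcd (snd s) n dvd d \<or> gcd (snd s) n dvd e"
  defines "f \<equiv> \<lambda>x. \<Sum>i | i < length A \<and> snd (A ! i) = n. of_bool (x \<in> progression (A ! i)) :: int"
  shows "f (x + int d + int e) + f x = f (x + int d) + f (x + int e)"
proof -
  \<comment> \<open>A common multiple of all moduli, so that one range of translates serves every
    entry.\<close>
  define M where "M = prod_list (map snd A)"
  have dvd_M: "snd (A ! i) dvd M" if "i < length A" for i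
    unfolding M_def using that by (intro prod_list_dvd) auto
  have "M > 0"
    using assms(1) unfolding M_def ECS_def by (force simp: prod_list_zero_iff intro!: Nat.gr0I)
  define F where "F = (\<lambda>i x. \<Sum>j<M. of_bool (x + int n * int j \<in> progression (A ! i)) :: int)"
  define I where "I = {i. i < length A \<and> snd (A ! i) = n}"
  define J where "J = {i. i < length A \<and> snd (A ! i) \<noteq> n}"
  have IJ: "{..<length A} = I \<union> J" "I \<inter> J = {}" "finite I" "finite J"
    unfolding I_def J_def by auto
  have one: "(\<Sum>i<length A. of_bool (x \<in> progression (A ! i))) = (1::int)" for x
  proof -
    have "card {i. i < length A \<and> x \<in> progression (A ! i)} = 1"
      using assms(1) unfolding ECS_def ex1_iff_card by blast
    moreover have "{i. i < length A \<and> x \<in> progression (A ! i)} =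
        {..<length A} \<inter> {i. x \<in> progression (A ! i)}" by auto
    ultimately show ?thesis by (simp add: sum_of_bool_eq)
  qed
  have "F i x = int M * of_bool (x \<in> progression (A ! i))" if "i \<in> I" for i x
  proof -
    obtain a where a: "A ! i = (a, n)" using \<open>i \<in> I\<close> unfolding I_def by (cases "A ! i") auto
    have "int n dvd x + int n * int j - a \<longleftrightarrow> int n dvd x - a" for j
      using dvd_add_left_iff[of "int n" "int n * int j" "x - a"] by (simp add: algebra_simps)
    then show ?thesis
      unfolding F_def a mem_progression_iff by simp
  qed
  then have "(\<Sum>i\<in>I. F i x) = int M * f x" for x
    by (simp add: f_def I_def[symmetric] sum_distrib_left)
  moreover have "(\<Sum>i\<in>I. F i x) + (\<Sum>i\<in>J. F i x) = int M" for x
  proof -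
    have "(\<Sum>i<length A. F i x) = int M"
      unfolding F_def by (subst sum.swap) (simp add: one)
    then show ?thesis unfolding IJ(1) using IJ by (simp add: sum.union_disjoint)
  qed
  ultimately have Mf: "int M * f x = int M - (\<Sum>i\<in>J. F i x)" for x
    by (metis add_diff_cancel_right')
  have "F i (x + int d + int e) + F i x = F i (x + int d) + F i (x + int e)" if "i \<in> J" for i
  proof -
    obtain a m where am: "A ! i = (a, m)" by fastforce
    have i: "i < length A" "m \<noteq> n" "m dvd M"
      using that dvd_M[of i] am unfolding J_def by auto
    then have "gcd m n dvd d \<or> gcd m n dvd e"
      using dvd[of "A ! i"] am nth_mem[of i A] by simp
    then have "(\<forall>x. F i (x + int d) = F i x) \<or> (\<forall>x. F i (x + int e) = F i x)"
      unfolding F_def am using sum_translates_periodic[OF i(3)] by blast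
    then show ?thesis by (metis add.commute add.left_commute)
  qed
  then have "(\<Sum>i\<in>J. F i (x + int d + int e)) + (\<Sum>i\<in>J. F i x) =
      (\<Sum>i\<in>J. F i (x + int d)) + (\<Sum>i\<in>J. F i (x + int e))"
    by (simp flip: sum.distrib)
  then have "int M * f (x + int d + int e) + int M * f x = int M * f (x + int d) + int M * f (x + int e)"
    unfolding Mf by linarith
  then have "int M * (f (x + int d + int e) + f x) = int M * (f (x + int d) + f (x + int e))"
    by (simp add: distrib_left)
  then show ?thesis using \<open>M > 0\<close> by simp
qed

section \<open>The maximal modulus and its prime divisors\<close>

text \<open>This excludes maximal modulus 1, which divides every modulus and so forces all of them
  to be 1.\<close>

lemma ECS_modulus_1:
  assumes "ECS A" and "\<And>s. s \<in> set A \<Longrightarrow> snd s = 1"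
  shows "progressions A = progressions [(0, 1)]"
proof -
  have UNIV: "progression s = UNIV" if "s \<in> set A" for s
    using assms(2)[OF that] by (cases s) (auto simp: mem_progression_iff simp del: progression.simps)
  have "size {#s \<in># mset A. 0 \<in> progression s#} = 1"
    using assms(1) unfolding ECS_iff by blast
  moreover have "{#s \<in># mset A. 0 \<in> progression s#} = mset A"
    by (simp add: filter_mset_eq_conv UNIV)
  ultimately obtain s where "mset A = {#s#}" by (metis size_1_singleton_mset)
  then have "A = [s]" by simp
  moreover have "progression (0, 1) = UNIV"
    by (auto simp: mem_progression_iff simp del: progression.simps)
  ultimately show ?thesis using UNIV by (simp add: progressions_def del: progression.simps)
qed

text \<open>If \<open>r\<close> is a prime factor of \<open>n div g\<close>, then \<open>g\<close>
  divides \<open>n div r\<close>, and \<open>n\<close> has at most two prime divisors. For a prime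
  power, \<open>p = q\<close>.\<close>

lemma two_primes_cover_proper_divisors:
  fixes p1 p2 k1 k2 :: nat
  assumes "prime p1" "prime p2" and n: "n = p1 ^ k1 * p2 ^ k2" and "n \<noteq> 1"
  obtains p q where "prime p" "prime q" "p dvd n" "q dvd n"
    "\<And>g. g dvd n \<Longrightarrow> g \<noteq> n \<Longrightarrow> g dvd n div p \<or> g dvd n div q"
proof -
  have r: "r = p1 \<and> k1 > 0 \<or> r = p2 \<and> k2 > 0" if "prime r" "r dvd n" for r
    using that assms(1,2) unfolding n
    by (metis dvd_1_left not_gr_zero power_0 prime_dvd_mult_iff prime_dvd_power_nat primes_dvd_imp_eq
        not_prime_unit)
  obtain p q where pq: "prime p" "prime q" "p dvd n" "q dvd n"
    and cover: "\<And>r. prime r \<Longrightarrow> r dvd n \<Longrightarrow> r = p \<or> r = q"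
  proof (cases "k1 = 0 \<or> k2 = 0")
    case True
    obtain p where p: "prime p" "p dvd n" using \<open>n \<noteq> 1\<close> prime_factor_nat by blast
    with True show ?thesis using that[of p p] r by (metis less_irrefl)
  next
    case False
    then show ?thesis using that[of p1 p2] r assms(1,2) by (auto simp: n)
  qed
  show ?thesis
  proof (rule that[OF pq])
    fix g assume "g dvd n" "g \<noteq> n"
    then obtain m where m: "n = g * m" by (auto elim: dvdE)
    with \<open>g \<noteq> n\<close> have "m \<noteq> 1" by auto
    then obtain r where r: "prime r" "r dvd m" using prime_factor_nat by blast
    then have "g dvd n div r"
      unfolding m by (metis div_mult_swap dvd_triv_left)
    moreover have "r = p \<or> r = q" using cover r m by simp
    ultimately show "g dvd n div p \<or> g dvd n div q" by blast
  qed
qed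

theorem theoremA:
  fixes A :: "(int \<times> nat) list" and p1 p2 k1 k2 :: nat
  assumes "ECS A"
    and "progressions A \<noteq> progressions [(0, 1)]"
    and "prime p1" and "prime p2"
    and "maximal_modulus A (p1 ^ k1 * p2 ^ k2)"
  shows "\<exists>B. ECS B \<and> A \<Turnstile> B"
proof -
  define n where "n = p1 ^ k1 * p2 ^ k2"
  have n_in: "n \<in> snd ` set A" and max: "\<And>s. s \<in> set A \<Longrightarrow> n dvd snd s \<Longrightarrow> snd s = n"
    using assms(5) unfolding maximal_modulus_def n_def by auto
  have "n > 0" unfolding n_def using assms(3,4) by (simp add: prime_gt_0_nat)
  have "n \<noteq> 1"
    using ECS_modulus_1[OF assms(1)] assms(2) max by auto
  then obtain p q where pq: "prime p" "prime q" "p dvd n" "q dvd n"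
    and cover: "\<And>g. g dvd n \<Longrightarrow> g \<noteq> n \<Longrightarrow> g dvd n div p \<or> g dvd n div q"
    using two_primes_cover_proper_divisors[OF assms(3,4) n_def] by metis
  define d e where "d = n div p" and "e = n div q"
  have de: "p * d = n" "q * e = n" "d \<ge> 1" "e \<ge> 1"
    using pq \<open>n > 0\<close> by (auto simp: d_def e_def div_dvd_iff_mult dvd_div_eq_0_iff Suc_le_eq
        intro!: Nat.gr0I)
  define f where
    "f = (\<lambda>x. \<Sum>i | i < length A \<and> snd (A ! i) = n. of_bool (x \<in> progression (A ! i)) :: int)"
  \<comment> \<open>If the gcd were \<open>n\<close>, then \<open>n\<close> would divide
    \<open>snd s\<close>, and maximality would give \<open>snd s = n\<close>.\<close>
  have "gcd (snd s) n dvd d \<or> gcd (snd s) n dvd e" if "s \<in> set A" "snd s \<noteq> n" for s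
    unfolding d_def e_def using that max cover[of "gcd (snd s) n"] by (metis gcd_dvd1 gcd_dvd2)
  then have diff: "f (x + int i * int d + int j * int e) + f x =
      f (x + int i * int d) + f (x + int j * int e)" for x i j
    unfolding f_def
    by (intro mixed_difference_zero ECS_mixed_difference[OF assms(1)]) auto
  have nonneg: "f x \<ge> 0" for x
    unfolding f_def by (intro sum_nonneg) simp
  have f_pos: "\<exists>s\<in>set A. progression s = progression (x, n)" if nz: "f x \<noteq> 0" for x
  proof -
    obtain i where i: "i < length A" "snd (A ! i) = n" "x \<in> progression (A ! i)"
      using nz unfolding f_def
      by (auto elim!: sum.not_neutral_contains_not_neutral simp del: progression.simps)
    then obtain a where a: "A ! i = (a, n)" by (cases "A ! i") auto
    then have "progression (A ! i) = progression (x, n)"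
      using i(3) progression_eqI by simp
    then show ?thesis using i(1) nth_mem by blast
  qed
  obtain c where "(c, n) \<in> set A" using n_in by auto
  then obtain i where i: "i < length A" "A ! i = (c, n)" by (auto simp: in_set_conv_nth)
  have "f c > 0"
    unfolding f_def using i
    by (intro sum_pos2[of _ i]) (auto simp: mem_progression_iff simp del: progression.simps)
  \<comment> \<open>Zeros at some \<open>c + int i * int d\<close> and some
    \<open>c + int j * int e\<close> would make the right side of \<open>diff\<close> zero, while
    its left side is at least \<open>f c > 0\<close>.\<close>
  then have "(\<forall>i. f (c + int i * int d) \<noteq> 0) \<or> (\<forall>j. f (c + int j * int e) \<noteq> 0)"
    using diff[of c] nonneg by (smt (verit))
  then show ?thesis
  proof
    assume "\<forall>i. f (c + int i * int d) \<noteq> 0"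
    \<comment> \<open>The values at \<open>i < p\<close> put all \<open>p\<close> pieces of
      \<open>c(d)\<close> in \<open>A\<close>, as \<open>p * d = n\<close>.\<close>
    then show ?thesis using ECS_merge[OF assms(1) pq(1) de(3)] f_pos de(1) by metis
  next
    assume "\<forall>j. f (c + int j * int e) \<noteq> 0"
    then show ?thesis using ECS_merge[OF assms(1) pq(2) de(4)] f_pos de(2) by metis
  qed
qed

end
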